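(* Let $\rho=\sigma+it$ be a zero of $Z_F$ with $1/2\le\sigma<\sigma_F$. Then $$2^{-\sigma}|2^{-it}+1|^2+3^{-\sigma}|3^{-it}+1|^2\le\frac{2H(\sigma)}{1-K(\sigma)}.$$ Write $$E(\rho)=\sum_{\substack{n\ge5\\ n\ne6,12}}F_n^{-\sigma}F_n^{-it}$$ and $\omega=E(\rho)/|E(\rho)|$. Then $$\sum_{\substack{n\ge5\\ n\ne6,12}}F_n^{-\sigma}|F_n^{-it}-\omega|^2\le2H(\sigma)$$ and $$|\omega+1|^2\le\frac{2H(\sigma)}{L(\sigma)+H(\sigma)}.$$ Consequently, for every $n\ge5$ with $n\ne6,12$, $$|F_n^{-it}+1|\le\sqrt{2H(\sigma)F_n^{\sigma}}+\sqrt{\frac{2H(\sigma)}{L(\sigma)+H(\sigma)}}.$$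
   Context: $F_1=F_2=1$, $F_{n+2}=F_{n+1}+F_n$ are the Fibonacci numbers, and $Z_F(s)=\sum_{n\ge1}F_n^{-s}$ for $\operatorname{Re}s>0$. For $\sigma>0$ put $$H(\sigma)=Z_F(\sigma)-4-2\cdot144^{-\sigma},\qquad L(\sigma)=2-2^{-\sigma}-3^{-\sigma}-8^{-\sigma}+144^{-\sigma},$$ $$K(\sigma)=72^{-\sigma}+18^{-\sigma}+4\cdot48^{-\sigma},$$ where $K(\sigma)<1$ for $\sigma\ge1/2$. $\sigma_F=0.7431\ldots$ is the unique zero of $H$ in $(0.7,0.75)$. *)

theory Defs
  imports "HOL-Analysis.Analysis" "HOL-Number_Theory.Fib"
begin

text \<open>
  All series below converge absolutely in the range where they are used (real part of the
  exponent positive), so \<open>infsum\<close> never takes its default value there.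
\<close>

definition Z_F :: "complex \<Rightarrow> complex" where
  "Z_F s = (\<Sum>\<^sub>\<infinity>n\<in>{1..}. of_nat (fib n) powr (- s))"

text \<open>On the positive real axis \<open>Z_F\<close> is real-valued, so taking the real part only changes the type.\<close>

definition H :: "real \<Rightarrow> real" where
  "H \<sigma> = Re (Z_F (complex_of_real \<sigma>)) - 4 - 2 * 144 powr (- \<sigma>)"

definition L :: "real \<Rightarrow> real" where
  "L \<sigma> = 2 - 2 powr (- \<sigma>) - 3 powr (- \<sigma>) - 8 powr (- \<sigma>) + 144 powr (- \<sigma>)"

definition K :: "real \<Rightarrow> real" where
  "K \<sigma> = 72 powr (- \<sigma>) + 18 powr (- \<sigma>) + 4 * 48 powr (- \<sigma>)"

definition sigma_F :: real where
  "sigma_F = (THE \<sigma>. \<sigma> \<in> {0.7<..<0.75} \<and> H \<sigma> = 0)"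

definition tail_indices :: "nat set" where
  "tail_indices = {n. n \<ge> 5 \<and> n \<noteq> 6 \<and> n \<noteq> 12}"

definition E :: "complex \<Rightarrow> complex" where
  "E \<rho> = (\<Sum>\<^sub>\<infinity>n\<in>tail_indices.
     complex_of_real (real (fib n) powr (- Re \<rho>)) * of_nat (fib n) powr (- (\<i> * of_real (Im \<rho>))))"

definition omega :: "complex \<Rightarrow> complex" where
  "omega \<rho> = E \<rho> / of_real (cmod (E \<rho>))"

end

theory Submission
  imports Defs
begin

text \<open>
  Put \<open>a = 2\<^bsup>-it\<^esup>\<close>, \<open>b = 3\<^bsup>-it\<^esup>\<close> and let \<open>T\<close> be the sum of \<open>F\<^sub>n\<^bsup>-\<sigma>\<^esup>\<close> over the tail indices,
  so that \<open>T = L(\<sigma>) + H(\<sigma>)\<close>. The equation \<open>Z\<^sub>F(\<rho>) = 0\<close> expresses \<open>-Re E(\<rho>) - L(\<sigma>)\<close> as half of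
  \<open>S - 144\<^bsup>-\<sigma>\<^esup> |a\<^sup>4 b\<^sup>2 - 1|\<^sup>2\<close>, where
  \<open>S = 2\<^bsup>-\<sigma>\<^esup>|a + 1|\<^sup>2 + 3\<^bsup>-\<sigma>\<^esup>|b + 1|\<^sup>2 + 8\<^bsup>-\<sigma>\<^esup>|a\<^sup>3 + 1|\<^sup>2\<close>. Splitting \<open>a\<^sup>4 b\<^sup>2 = a\<^sup>3 a b\<^sup>2\<close>, the triangle
  inequality and Cauchy-Schwarz bound the negative term by \<open>K(\<sigma>) S\<close>. Hence
  \<open>L(\<sigma>) + (1 - K(\<sigma>)) S / 2 \<le> -Re E(\<rho>) \<le> |E(\<rho>)| \<le> T\<close>, and all claims follow.
\<close>

section \<open>Convergence of the Fibonacci Dirichlet series\<close>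

lemma three_halves_power_le_fib: "(3/2) ^ Suc n \<le> 3 * real (fib (Suc n))"
  \<comment> \<open>The ratio 3/2 survives the recurrence because 1 + 3/2 >= (3/2)^2; the factor 3
    leaves room for the two base cases.\<close>
  by (induction n rule: fib.induct) simp_all

lemma summable_on_fib_powr:
  assumes "\<sigma> > 0"
  shows "(\<lambda>n. real (fib n) powr (- \<sigma>)) summable_on {1..}"
proof -
  define q where "q = (3/2 :: real) powr (- \<sigma>)"
  have q: "0 < q" "q < 1"
    using assms by (auto simp: q_def powr_less_one)
  have le: "norm (real (fib n) powr (- \<sigma>)) \<le> 3 powr \<sigma> * q ^ n" if "n \<in> {1..}" for n
  proof -
    from that obtain m where n: "n = Suc m"
      by (cases n) auto
    have "real (fib n) powr (- \<sigma>) \<le> ((3/2) ^ n / 3) powr (- \<sigma>)"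
      using three_halves_power_le_fib[of m] assms
      by (intro powr_mono2') (auto simp: n)
    also have "\<dots> = 3 powr \<sigma> * q ^ n"
      by (simp add: q_def powr_divide powr_mult powr_minus powr_realpow [symmetric] powr_powr field_simps)
    finally show ?thesis by simp
  qed
  have "summable (\<lambda>n. 3 powr \<sigma> * q ^ n)"
    using q by (intro summable_mult summable_geometric) auto
  then have "(\<lambda>n. 3 powr \<sigma> * q ^ n) summable_on UNIV"
    using q by (subst summable_on_UNIV_nonneg_real_iff) auto
  then have "(\<lambda>n. 3 powr \<sigma> * q ^ n) summable_on {1..}"
    by (rule summable_on_subset_banach) auto
  then have "(\<lambda>n. norm (real (fib n) powr (- \<sigma>))) summable_on {1..}"
    by (rule summable_on_comparison_test) (use le in auto)
  then show ?thesis
    by simp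
qed

section \<open>Unimodular phases and their deviations\<close>

lemma norm_of_nat_powr_imaginary:
  assumes "m > 0"
  shows "cmod (of_nat m powr (- (\<i> * of_real t))) = 1"
  using assms by (simp add: norm_powr_real_powr)

lemma of_nat_mult_powr_complex:
  fixes s :: complex
  assumes "m > 0" "n > 0"
  shows "of_nat (m * n) powr s = of_nat m powr s * of_nat n powr s"
  using powr_times_real[of "of_nat m" "of_nat n" s] by simp

text \<open>Bridges two encodings: \<open>Z_F\<close> uses one complex exponent, \<open>E\<close>
  separates modulus and phase.\<close>

lemma of_nat_powr_Complex:
  assumes "m > 0"
  shows "of_nat m powr (- Complex \<sigma> t)
    = of_real (real m powr (- \<sigma>)) * of_nat m powr (- (\<i> * of_real t))"
proof -
  have "- Complex \<sigma> t = of_real (- \<sigma>) + - (\<i> * of_real t)"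
    by (simp add: complex_eq_iff)
  moreover have "(of_nat m :: complex) powr of_real (- \<sigma>) = of_real (real m powr (- \<sigma>))"
    using powr_of_real[of "real m" "- \<sigma>"] by simp
  ultimately show ?thesis
    by (simp only: powr_add)
qed

lemma norm_diff_unit_square:
  assumes "cmod z = 1" "cmod w = 1"
  shows "(cmod (z - w))\<^sup>2 = 2 - 2 * Re (z * cnj w)"
proof -
  have "(cmod z)\<^sup>2 = 1" "(cmod w)\<^sup>2 = 1"
    using assms by simp_all
  then show ?thesis
    unfolding cmod_power2 by (simp add: power2_eq_square algebra_simps)
qed

lemma norm_unit_add_one_square:
  assumes "cmod z = 1"
  shows "(cmod (z + 1))\<^sup>2 = 2 + 2 * Re z"
  using norm_diff_unit_square[of z "- 1"] assms by simp

text \<open>Each squared distance expands to 2 - 2 Re(u cnj v), and the fixed v comes out of the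
  sum. For v the direction of S, the total is 2(T - |S|), twice the defect in the triangle
  inequality.\<close>

lemma has_sum_unit_deviation:
  assumes w: "(w has_sum T) A"
    and u: "((\<lambda>n. of_real (w n) * u n) has_sum S) A"
    and unit: "\<And>n. n \<in> A \<Longrightarrow> cmod (u n) = 1" "cmod v = 1"
  shows "((\<lambda>n. w n * (cmod (u n - v))\<^sup>2) has_sum 2 * T - 2 * Re (S * cnj v)) A"
proof -
  have "((\<lambda>n. 2 * w n + - 2 * Re (of_real (w n) * u n * cnj v)) has_sum
      2 * T + - 2 * Re (S * cnj v)) A"
    by (intro has_sum_add has_sum_cmult_right has_sum_Re has_sum_cmult_left w u)
  also have "2 * T + - 2 * Re (S * cnj v) = 2 * T - 2 * Re (S * cnj v)"
    by simp
  finally have "((\<lambda>n. 2 * w n + - 2 * Re (of_real (w n) * u n * cnj v)) has_sum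
      2 * T - 2 * Re (S * cnj v)) A" .
  moreover have "2 * w n + - 2 * Re (of_real (w n) * u n * cnj v) = w n * (cmod (u n - v))\<^sup>2"
    if "n \<in> A" for n
    unfolding norm_diff_unit_square[OF unit(1)[OF that] unit(2)] by (simp add: algebra_simps)
  ultimately show ?thesis
    using has_sum_cong by (metis (no_types, lifting))
qed

section \<open>Absorbing the term at 144\<close>

lemma Cauchy_Schwarz_three:
  fixes p q r :: real
  assumes "\<alpha> > 0" "\<beta> > 0" "\<gamma> > 0"
  shows "(p + q + r)\<^sup>2 \<le> (1/\<alpha> + 1/\<beta> + 1/\<gamma>) * (\<alpha> * p\<^sup>2 + \<beta> * q\<^sup>2 + \<gamma> * r\<^sup>2)"
proof -
  \<comment> \<open>Lagrange's identity: the defect is a sum of squares.\<close>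
  have "(1/\<alpha> + 1/\<beta> + 1/\<gamma>) * (\<alpha> * p\<^sup>2 + \<beta> * q\<^sup>2 + \<gamma> * r\<^sup>2) - (p + q + r)\<^sup>2
      = (\<alpha> * p - \<beta> * q)\<^sup>2 / (\<alpha> * \<beta>) + (\<alpha> * p - \<gamma> * r)\<^sup>2 / (\<alpha> * \<gamma>) + (\<beta> * q - \<gamma> * r)\<^sup>2 / (\<beta> * \<gamma>)"
    using assms by (simp add: field_simps power2_eq_square)
  also have "\<dots> \<ge> 0"
    using assms by simp
  finally show ?thesis by simp
qed

lemma norm_unit_product_minus_one_le:
  assumes "cmod a = 1" "cmod b = 1"
  shows "cmod (a^4 * b^2 - 1) \<le> cmod (a^3 + 1) + cmod (a + 1) + 2 * cmod (b + 1)"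
proof -
  \<comment> \<open>Telescoping: the factors a^3, a, b, b are replaced by -1 one at a time. Their
    number is even, so the chain ends at 1.\<close>
  have *: "a^4 * b^2 - 1 = (a^3 + 1) * (a * b^2) - (a + 1) * b^2 + (b + 1) * b - (b + 1)"
    by (simp add: algebra_simps power_numeral_reduce)
  have "cmod (a^4 * b^2 - 1) \<le>
      cmod ((a^3 + 1) * (a * b^2)) + cmod ((a + 1) * b^2) + cmod ((b + 1) * b) + cmod (b + 1)"
    unfolding * by norm
  then show ?thesis
    using assms by (simp add: norm_mult norm_power)
qed

lemma norm_unit_product_minus_one_square_le:
  assumes "cmod a = 1" "cmod b = 1"
  shows "144 powr (- \<sigma>) * (cmod (a^4 * b^2 - 1))\<^sup>2 \<le> K \<sigma> *
    (2 powr (- \<sigma>) * (cmod (a + 1))\<^sup>2 + 3 powr (- \<sigma>) * (cmod (b + 1))\<^sup>2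
      + 8 powr (- \<sigma>) * (cmod (a^3 + 1))\<^sup>2)"
    (is "_ \<le> K \<sigma> * ?S")
proof -
  let ?p = "cmod (a^3 + 1)" and ?q = "cmod (a + 1)" and ?r = "cmod (b + 1)"
  have "(cmod (a^4 * b^2 - 1))\<^sup>2 \<le> (?p + ?q + 2 * ?r)\<^sup>2"
    using norm_unit_product_minus_one_le[OF assms] by (intro power_mono) auto
  \<comment> \<open>The weight of the last term is divided by 4 to offset the square of 2 in
    \<open>2 * ?r\<close>; its reciprocal yields the coefficient 4 in \<open>K\<close>.\<close>
  also have "\<dots> \<le> (1 / 8 powr (- \<sigma>) + 1 / 2 powr (- \<sigma>) + 1 / (3 powr (- \<sigma>) / 4)) *
      (8 powr (- \<sigma>) * ?p\<^sup>2 + 2 powr (- \<sigma>) * ?q\<^sup>2 + 3 powr (- \<sigma>) / 4 * (2 * ?r)\<^sup>2)"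
    by (intro Cauchy_Schwarz_three) auto
  also have "\<dots> = (8 powr \<sigma> + 2 powr \<sigma> + 4 * 3 powr \<sigma>) * ?S"
    by (simp add: powr_minus field_simps power_mult_distrib)
  finally have "144 powr (- \<sigma>) * (cmod (a^4 * b^2 - 1))\<^sup>2
      \<le> 144 powr (- \<sigma>) * ((8 powr \<sigma> + 2 powr \<sigma> + 4 * 3 powr \<sigma>) * ?S)"
    by (intro mult_left_mono) auto
  also have "\<dots> = (144 powr (- \<sigma>) * (8 powr \<sigma> + 2 powr \<sigma> + 4 * 3 powr \<sigma>)) * ?S"
    by (rule mult.assoc [symmetric])
  \<comment> \<open>The bases in \<open>K\<close> are 144/2, 144/8 and 144/3.\<close>
  also have "144 powr (- \<sigma>) * (8 powr \<sigma> + 2 powr \<sigma> + 4 * 3 powr \<sigma>) = K \<sigma>"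
  proof -
    have "(144::real) powr \<sigma> = 18 powr \<sigma> * 8 powr \<sigma>" "(144::real) powr \<sigma> = 72 powr \<sigma> * 2 powr \<sigma>"
      "(144::real) powr \<sigma> = 48 powr \<sigma> * 3 powr \<sigma>"
      by (simp_all flip: powr_mult)
    then have "8 powr \<sigma> / (144::real) powr \<sigma> = 1 / 18 powr \<sigma>"
      "2 powr \<sigma> / (144::real) powr \<sigma> = 1 / 72 powr \<sigma>"
      "3 powr \<sigma> / (144::real) powr \<sigma> = 1 / 48 powr \<sigma>"
      by (simp_all add: field_simps)
    then show ?thesis
      by (simp add: K_def powr_minus_divide distrib_left add_divide_distrib)
  qed
  finally show ?thesis .
qed

section \<open>Numerical bounds for \<open>K\<close> and \<open>L\<close>\<close>

lemma powr_minus_le_of_half_le: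
  fixes x d :: real
  assumes "1/2 \<le> \<sigma>" "x \<ge> 1" "d > 0" "1 \<le> x * d\<^sup>2"
  shows "x powr (- \<sigma>) \<le> d"
proof -
  \<comment> \<open>The worst case is \<sigma> = 1/2, where the bound 1/sqrt x <= d follows from a
    rational inequality.\<close>
  have "x powr (- \<sigma>) \<le> x powr (- (1/2))"
    using assms by (intro powr_mono) auto
  also have "\<dots> = 1 / sqrt x"
    using assms by (simp add: powr_minus_divide powr_half_sqrt)
  also have "\<dots> \<le> d"
  proof -
    have "1 \<le> sqrt (x * d\<^sup>2)"
      using assms by simp
    then show ?thesis
      using assms by (simp add: real_sqrt_mult field_simps)
  qed
  finally show ?thesis .
qed

lemma K_less_one:
  assumes "1/2 \<le> \<sigma>"
  shows "K \<sigma> < 1"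
proof -
  \<comment> \<open>Reciprocal square roots rounded up: 0.12 + 0.24 + 4 * 0.15 = 0.96.\<close>
  have "72 powr (- \<sigma>) \<le> (12/100 :: real)" "18 powr (- \<sigma>) \<le> (24/100 :: real)"
    "48 powr (- \<sigma>) \<le> (15/100 :: real)"
    by (rule powr_minus_le_of_half_le[OF assms]; simp add: power2_eq_square)+
  then show ?thesis
    by (simp add: K_def)
qed

lemma L_pos:
  assumes "1/2 \<le> \<sigma>"
  shows "0 < L \<sigma>"
proof -
  \<comment> \<open>These bounds leave at least 2 - 1.75 = 0.25.\<close>
  have "2 powr (- \<sigma>) \<le> (75/100 :: real)" "3 powr (- \<sigma>) \<le> (60/100 :: real)"
    "8 powr (- \<sigma>) \<le> (40/100 :: real)"
    by (rule powr_minus_le_of_half_le[OF assms]; simp add: power2_eq_square)+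
  moreover have "0 < (144::real) powr (- \<sigma>)" by simp
  ultimately show ?thesis
    unfolding L_def by linarith
qed

section \<open>Separating the terms built from 2 and 3\<close>

lemma fib_values:
  "fib 1 = 1" "fib 2 = 1" "fib 3 = 2" "fib 4 = 3" "fib 6 = 8" "fib 12 = 144"
  by (simp_all add: eval_nat_numeral)

text \<open>The separated Fibonacci values are products of powers of 2 and 3, so their phases are
  monomials in a and b.\<close>

lemma atLeast_one_eq_tail_indices: "{1::nat..} = {1, 2, 3, 4, 6, 12} \<union> tail_indices"
  by (auto simp: tail_indices_def)

text \<open>Holds at any point with positive real part, so it serves both at the zero and at the
  real point \<sigma>.\<close>

lemma Z_F_split:
  assumes "\<sigma> > 0" and "t = Im \<rho>" and "\<sigma> = Re \<rho>"
  defines "c \<equiv> \<lambda>m::nat. of_nat m powr (- (\<i> * of_real t)) :: complex"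
  shows "((\<lambda>n. of_real (real (fib n) powr (- \<sigma>)) * c (fib n)) has_sum E \<rho>) tail_indices"
    and "Z_F \<rho> = 2 + of_real (2 powr (- \<sigma>)) * c 2 + of_real (3 powr (- \<sigma>)) * c 3
      + of_real (8 powr (- \<sigma>)) * c 8 + of_real (144 powr (- \<sigma>)) * c 144 + E \<rho>"
proof -
  define f where "f = (\<lambda>n. of_real (real (fib n) powr (- \<sigma>)) * c (fib n))"
  have norm_f: "norm (f n) = real (fib n) powr (- \<sigma>)" if "n \<in> {1..}" for n
    using that norm_of_nat_powr_imaginary[of "fib n" t]
    by (simp add: f_def c_def norm_mult fib_neq_0_nat)
  have "(\<lambda>n. norm (f n)) summable_on {1..}"
    using summable_on_cong[THEN iffD2, OF norm_f summable_on_fib_powr[OF assms(1)]] by simp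
  then have "f summable_on {1..}"
    by (rule abs_summable_summable)
  then have tail: "f summable_on tail_indices"
    by (rule summable_on_subset_banach) (auto simp: tail_indices_def)
  have E: "E \<rho> = infsum f tail_indices"
    by (simp add: E_def f_def c_def assms(2,3))
  show "(f has_sum E \<rho>) tail_indices"
    unfolding E using tail by (rule has_sum_infsum)
  have \<rho>: "\<rho> = Complex \<sigma> t"
    by (simp add: assms(2,3))
  have "Z_F \<rho> = infsum f {1..}"
    unfolding Z_F_def f_def c_def \<rho>
    by (intro infsum_cong of_nat_powr_Complex) (simp add: fib_neq_0_nat)
  also have "\<dots> = infsum f {1, 2, 3, 4, 6, 12} + infsum f tail_indices"
    unfolding atLeast_one_eq_tail_indices
    by (rule infsum_Un_disjoint) (use tail in \<open>auto simp: tail_indices_def\<close>)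
  also have "infsum f {1, 2, 3, 4, 6, 12} = f 1 + f 2 + f 3 + f 4 + f 6 + f 12"
    by simp
  finally show "Z_F \<rho> = 2 + of_real (2 powr (- \<sigma>)) * c 2 + of_real (3 powr (- \<sigma>)) * c 3
      + of_real (8 powr (- \<sigma>)) * c 8 + of_real (144 powr (- \<sigma>)) * c 144 + E \<rho>"
    unfolding E f_def fib_values by (simp add: c_def)
qed

text \<open>At the real point \<sigma> every phase is 1, so \<open>E\<close> becomes the sum of the
  moduli; subtracting the separated terms from \<open>Z_F\<close> leaves
  \<open>L \<sigma> + H \<sigma>\<close>.\<close>

lemma has_sum_tail_fib_powr:
  assumes "\<sigma> > 0"
  shows "((\<lambda>n. real (fib n) powr (- \<sigma>)) has_sum L \<sigma> + H \<sigma>) tail_indices"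
proof -
  have pos: "fib n > 0" if "n \<in> tail_indices" for n
    using that by (auto simp: tail_indices_def intro: fib_neq_0_nat)
  have Re_E: "((\<lambda>n. real (fib n) powr (- \<sigma>)) has_sum Re (E (of_real \<sigma>))) tail_indices"
  proof (rule has_sum_cong[THEN iffD1])
    show "((\<lambda>n. Re (of_real (real (fib n) powr (- \<sigma>)) * of_nat (fib n) powr (- (\<i> * of_real 0))))
        has_sum Re (E (of_real \<sigma>))) tail_indices"
      using assms by (intro has_sum_Re Z_F_split(1)) auto
  qed (use pos in force)
  have "Re (E (of_real \<sigma>)) = L \<sigma> + H \<sigma>"
    using Z_F_split(2)[of \<sigma> 0 "of_real \<sigma>"] assms by (simp add: L_def H_def)
  with Re_E show ?thesis by simp
qed

text \<open>The deviation at 8 is retained because the term at 144 is controlled by all three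
  deviations together.\<close>

lemma zero_E_bounds:
  assumes "Z_F \<rho> = 0" and "\<sigma> > 0" and "t = Im \<rho>" and "\<sigma> = Re \<rho>"
  shows "L \<sigma> + (1 - K \<sigma>) / 2 *
      (2 powr (- \<sigma>) * (cmod (2 powr (- (\<i> * of_real t)) + 1))\<^sup>2
       + 3 powr (- \<sigma>) * (cmod (3 powr (- (\<i> * of_real t)) + 1))\<^sup>2
       + 8 powr (- \<sigma>) * (cmod (8 powr (- (\<i> * of_real t)) + 1))\<^sup>2) \<le> - Re (E \<rho>)"
    and "cmod (E \<rho>) \<le> L \<sigma> + H \<sigma>"
proof -
  define c where "c = (\<lambda>m::nat. of_nat m powr (- (\<i> * of_real t)) :: complex)"
  define a b where "a = c 2" and "b = c 3"
  have unit: "cmod a = 1" "cmod b = 1"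
    unfolding a_def b_def c_def by (rule norm_of_nat_powr_imaginary; simp)+
  have mult: "c (m * n) = c m * c n" if "m > 0" "n > 0" for m n
    unfolding c_def by (rule of_nat_mult_powr_complex[OF that])
  have c8: "c 8 = a^3"
    using mult[of 2 2] mult[of 4 2] by (simp add: a_def power_numeral_reduce)
  have c144: "c 144 = a^4 * b^2"
    using mult[of 8 2] mult[of 3 3] mult[of 16 9] c8
    by (simp add: a_def b_def power_numeral_reduce)
  define S where "S = 2 powr (- \<sigma>) * (cmod (a + 1))\<^sup>2 + 3 powr (- \<sigma>) * (cmod (b + 1))\<^sup>2
      + 8 powr (- \<sigma>) * (cmod (a^3 + 1))\<^sup>2"
  have "Z_F \<rho> = 2 + of_real (2 powr (- \<sigma>)) * c 2 + of_real (3 powr (- \<sigma>)) * c 3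
      + of_real (8 powr (- \<sigma>)) * c 8 + of_real (144 powr (- \<sigma>)) * c 144 + E \<rho>"
    unfolding c_def by (rule Z_F_split(2)[OF assms(2-4)])
  then have "Re (Z_F \<rho>) = 2 + 2 powr (- \<sigma>) * Re (c 2) + 3 powr (- \<sigma>) * Re (c 3)
      + 8 powr (- \<sigma>) * Re (c 8) + 144 powr (- \<sigma>) * Re (c 144) + Re (E \<rho>)"
    by simp
  then have "- Re (E \<rho>) = 2 + 2 powr (- \<sigma>) * Re a + 3 powr (- \<sigma>) * Re b
      + 8 powr (- \<sigma>) * Re (a^3) + 144 powr (- \<sigma>) * Re (a^4 * b^2)"
    unfolding assms(1) c8 c144 a_def [symmetric] b_def [symmetric] by simp
  \<comment> \<open>Deviations of a, b and a^3 are measured from -1, that of a^4 b^2 from +1, its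
    value at a = b = -1. This matches the signs in \<open>L\<close>.\<close>
  moreover have "2 * Re a = (cmod (a + 1))\<^sup>2 - 2" "2 * Re b = (cmod (b + 1))\<^sup>2 - 2"
    "2 * Re (a^3) = (cmod (a^3 + 1))\<^sup>2 - 2"
    by (simp_all add: norm_unit_add_one_square norm_power unit)
  moreover have "2 * Re (a^4 * b^2) = 2 - (cmod (a^4 * b^2 - 1))\<^sup>2"
    by (subst norm_diff_unit_square) (simp_all add: norm_mult norm_power unit)
  ultimately have "2 * (- Re (E \<rho>) - L \<sigma>) = S - 144 powr (- \<sigma>) * (cmod (a^4 * b^2 - 1))\<^sup>2"
    unfolding S_def L_def by algebra
  also have "\<dots> \<ge> S - K \<sigma> * S"
    using norm_unit_product_minus_one_square_le[OF unit, of \<sigma>] by (simp add: S_def)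
  finally have "L \<sigma> + (1 - K \<sigma>) / 2 * S \<le> - Re (E \<rho>)"
    by (simp add: field_simps)
  then show "L \<sigma> + (1 - K \<sigma>) / 2 *
      (2 powr (- \<sigma>) * (cmod (2 powr (- (\<i> * of_real t)) + 1))\<^sup>2
       + 3 powr (- \<sigma>) * (cmod (3 powr (- (\<i> * of_real t)) + 1))\<^sup>2
       + 8 powr (- \<sigma>) * (cmod (8 powr (- (\<i> * of_real t)) + 1))\<^sup>2) \<le> - Re (E \<rho>)"
    unfolding S_def c8 [symmetric] by (simp add: a_def b_def c_def)
  show "cmod (E \<rho>) \<le> L \<sigma> + H \<sigma>"
  proof (rule norm_infsum_le)
    show "((\<lambda>n. of_real (real (fib n) powr (- \<sigma>)) * c (fib n)) has_sum E \<rho>) tail_indices"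
      unfolding c_def by (rule Z_F_split(1)[OF assms(2-4)])
    show "((\<lambda>n. real (fib n) powr (- \<sigma>)) has_sum L \<sigma> + H \<sigma>) tail_indices"
      by (rule has_sum_tail_fib_powr[OF assms(2)])
    show "norm (of_real (real (fib n) powr (- \<sigma>)) * c (fib n)) \<le> real (fib n) powr (- \<sigma>)" for n
      by (cases "fib n = 0") (simp_all add: norm_mult c_def norm_of_nat_powr_imaginary)
  qed
qed

section \<open>From the bounds on \<open>E\<close> to the estimates\<close>

theorem proposition7p1:
  fixes \<rho> :: complex and \<sigma> t :: real
  assumes "\<rho> = Complex \<sigma> t"
    and "Z_F \<rho> = 0"
    and "1/2 \<le> \<sigma>" and "\<sigma> < sigma_F"
  shows
    "2 powr (- \<sigma>) * (cmod (2 powr (- (\<i> * of_real t)) + 1))\<^sup>2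
       + 3 powr (- \<sigma>) * (cmod (3 powr (- (\<i> * of_real t)) + 1))\<^sup>2
     \<le> 2 * H \<sigma> / (1 - K \<sigma>)
   \<and> E \<rho> \<noteq> 0
   \<and> (\<Sum>\<^sub>\<infinity>n\<in>tail_indices.
        real (fib n) powr (- \<sigma>) * (cmod (of_nat (fib n) powr (- (\<i> * of_real t)) - omega \<rho>))\<^sup>2)
     \<le> 2 * H \<sigma>
   \<and> (cmod (omega \<rho> + 1))\<^sup>2 \<le> 2 * H \<sigma> / (L \<sigma> + H \<sigma>)
   \<and> (\<forall>n::nat. n \<ge> 5 \<and> n \<noteq> 6 \<and> n \<noteq> 12 \<longrightarrow>
        cmod (of_nat (fib n) powr (- (\<i> * of_real t)) + 1)
        \<le> sqrt (2 * H \<sigma> * real (fib n) powr \<sigma>) + sqrt (2 * H \<sigma> / (L \<sigma> + H \<sigma>)))"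
proof -
  define c where "c = (\<lambda>m::nat. of_nat m powr (- (\<i> * of_real t)) :: complex)"
  define w where "w = (\<lambda>n. real (fib n) powr (- \<sigma>))"
  have \<sigma>: "\<sigma> > 0" and t: "t = Im \<rho>" and re: "\<sigma> = Re \<rho>"
    using assms by simp_all
  define S where "S = 2 powr (- \<sigma>) * (cmod (2 powr (- (\<i> * of_real t)) + 1))\<^sup>2
       + 3 powr (- \<sigma>) * (cmod (3 powr (- (\<i> * of_real t)) + 1))\<^sup>2"
  note K = K_less_one[OF assms(3)] and L = L_pos[OF assms(3)]
  have "0 \<le> (1 - K \<sigma>) / 2 * (8 powr (- \<sigma>) * (cmod (8 powr (- (\<i> * of_real t)) + 1))\<^sup>2)"
    using K by simp
  with zero_E_bounds(1)[OF assms(2) \<sigma> t re]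
  have Re_E: "L \<sigma> + (1 - K \<sigma>) / 2 * S \<le> - Re (E \<rho>)"
    unfolding S_def distrib_left by linarith
  have "0 \<le> S"
    by (simp add: S_def)
  then have "0 \<le> (1 - K \<sigma>) / 2 * S"
    using K by simp
  with Re_E have L_le: "L \<sigma> \<le> - Re (E \<rho>)"
    by linarith
  have Re_le: "- Re (E \<rho>) \<le> cmod (E \<rho>)"
    using abs_Re_le_cmod[of "E \<rho>"] by linarith
  note E_le = zero_E_bounds(2)[OF assms(2) \<sigma> t re]
  \<comment> \<open>Positivity of \<open>L\<close> keeps \<open>omega\<close> from being a division
    by zero.\<close>
  have E_pos: "cmod (E \<rho>) > 0"
    using L L_le Re_le by linarith
  then have E_nz: "E \<rho> \<noteq> 0" by simp
  have unit_\<omega>: "cmod (omega \<rho>) = 1"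
    using E_nz by (simp add: omega_def norm_divide)

  have first: "S \<le> 2 * H \<sigma> / (1 - K \<sigma>)"
  proof -
    \<comment> \<open>\<open>L \<sigma>\<close> cancels between the lower and upper bounds for
      |E|.\<close>
    have "(1 - K \<sigma>) / 2 * S \<le> H \<sigma>"
      using Re_E Re_le E_le by linarith
    then show ?thesis
      using K by (simp add: pos_le_divide_eq mult.commute)
  qed

  have unit_c: "cmod (c (fib n)) = 1" if "n \<in> tail_indices" for n
    unfolding c_def using that
    by (intro norm_of_nat_powr_imaginary fib_neq_0_nat) (auto simp: tail_indices_def)
  \<comment> \<open>\<open>omega\<close> points along \<open>E\<close>, so the total deviation is
    twice the gap between \<open>L \<sigma> + H \<sigma>\<close> and |E|.\<close>
  have "E \<rho> * cnj (omega \<rho>) = of_real (cmod (E \<rho>))"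
    using E_nz complex_norm_square[of "E \<rho>"] by (simp add: omega_def field_simps power2_eq_square)
  then have deviation: "((\<lambda>n. w n * (cmod (c (fib n) - omega \<rho>))\<^sup>2) has_sum
      2 * (L \<sigma> + H \<sigma>) - 2 * cmod (E \<rho>)) tail_indices"
    using has_sum_unit_deviation[of w tail_indices "L \<sigma> + H \<sigma>" "\<lambda>n. c (fib n)" "E \<rho>" "omega \<rho>"]
      has_sum_tail_fib_powr[OF \<sigma>] Z_F_split(1)[OF \<sigma> t re] unit_c unit_\<omega>
    by (simp add: w_def c_def)
  have deviation_le: "2 * (L \<sigma> + H \<sigma>) - 2 * cmod (E \<rho>) \<le> 2 * H \<sigma>"
    using L_le Re_le by simp
  have second: "(\<Sum>\<^sub>\<infinity>n\<in>tail_indices. w n * (cmod (c (fib n) - omega \<rho>))\<^sup>2) \<le> 2 * H \<sigma>"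
    using infsumI[OF deviation] deviation_le by simp

  have third: "(cmod (omega \<rho> + 1))\<^sup>2 \<le> 2 * H \<sigma> / (L \<sigma> + H \<sigma>)"
  proof -
    \<comment> \<open>The right side is -Re \<open>omega\<close>, and |omega + 1|^2 = 2 + 2 Re
      \<open>omega\<close>.\<close>
    have "L \<sigma> / (L \<sigma> + H \<sigma>) \<le> - Re (E \<rho>) / cmod (E \<rho>)"
      using L L_le E_le E_pos by (intro frac_le) auto
    moreover have "2 * H \<sigma> / (L \<sigma> + H \<sigma>) = 2 - 2 * (L \<sigma> / (L \<sigma> + H \<sigma>))"
    proof -
      have "L \<sigma> + H \<sigma> > 0"
        using E_le E_pos by linarith
      then show ?thesis by (simp add: field_simps)
    qed
    ultimately show ?thesis
      by (simp add: norm_unit_add_one_square[OF unit_\<omega>]) (simp add: omega_def)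
  qed

  have fourth: "cmod (c (fib n) + 1)
      \<le> sqrt (2 * H \<sigma> * real (fib n) powr \<sigma>) + sqrt (2 * H \<sigma> / (L \<sigma> + H \<sigma>))"
    if n: "n \<in> tail_indices" for n
  proof -
    have pos: "real (fib n) powr \<sigma> > 0"
      using n by (auto simp: tail_indices_def fib_neq_0_nat)
    have "w n * (cmod (c (fib n) - omega \<rho>))\<^sup>2 \<le> 2 * (L \<sigma> + H \<sigma>) - 2 * cmod (E \<rho>)"
      \<comment> \<open>One term of a nonnegative series is at most its sum.\<close>
      using has_sum_mono_neutral[OF has_sum_finite deviation, of "{n}"
          "\<lambda>n. w n * (cmod (c (fib n) - omega \<rho>))\<^sup>2"] n
      by (auto simp: w_def)
    then have "w n * (cmod (c (fib n) - omega \<rho>))\<^sup>2 \<le> 2 * H \<sigma>"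
      using deviation_le by linarith
    then have "(cmod (c (fib n) - omega \<rho>))\<^sup>2 \<le> 2 * H \<sigma> * real (fib n) powr \<sigma>"
      using pos by (simp add: w_def powr_minus field_simps)
    then have "cmod (c (fib n) - omega \<rho>) \<le> sqrt (2 * H \<sigma> * real (fib n) powr \<sigma>)"
      by (rule real_le_rsqrt)
    moreover have "cmod (omega \<rho> + 1) \<le> sqrt (2 * H \<sigma> / (L \<sigma> + H \<sigma>))"
      using third by (rule real_le_rsqrt)
    ultimately show ?thesis
      using norm_triangle_ineq[of "c (fib n) - omega \<rho>" "omega \<rho> + 1"] by simp
  qed

  show ?thesis
    using first E_nz second third fourth
    by (simp add: S_def w_def c_def tail_indices_def)
qed

end
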